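(* Let $m\ge4$ be even, $h=\frac m2$, $f_6(x)=x+x^{2^{h}}+x^{2^m-2^{h}+1}\in\mathbb{F}_{2^m}[x]$, and let $s^\infty$ be the sequence $s_t=\operatorname{Tr}(f_6(\alpha^t+1))$, $t\ge0$. Then the minimal polynomial of $s^\infty$ (generator polynomial of $\mathcal{C}_s$) is $$g_s(x)=\prod_{i\in\Gamma_{(h)}\setminus\{1\}}m_{\alpha^{-(i+2^{h})}}(x)\prod_{\substack{2\le j\le h-2\\ j\text{ even}}}\prod_{i\in\Gamma_{(j)}}m_{\alpha^{-(i+2^{j})}}(x)\cdot m_{\alpha^{-1}}(x)\quad\text{if } m\equiv0\pmod4,$$ $$g_s(x)=\prod_{i\in\Gamma_{(h)}\setminus\{1\}}m_{\alpha^{-(i+2^{h})}}(x)\prod_{\substack{1\le j\le h-2\\ j\text{ odd}}}\prod_{i\in\Gamma_{(j)}}m_{\alpha^{-(i+2^{j})}}(x)\quad\text{if } m\equiv2\pmod4.$$ The linear span is $L_s=m\cdot\frac{2^{m/2+1}-2}{3}$ if $m\equiv0\pmod4$ and $L_s=m\cdot\frac{2^{m/2+1}-4}{3}$ if $m\equiv2\pmod4$. Moreover, $\mathcal{C}_s$ has parameters $[2^m-1,\,2^m-1-L_s,\,d(\mathcal{C}_s)]$ with $2^{(m-2)/2}\le d(\mathcal{C}_s)\le L_s+1$.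
   Context: Let $v=2^m-1$, $\alpha$ a primitive element of $\mathbb{F}_{2^m}$, and $\operatorname{Tr}(x)=\sum_{i=0}^{m-1}x^{2^i}$ the absolute trace from $\mathbb{F}_{2^m}$ to $\mathbb{F}_2$. For a polynomial $F$ over $\mathbb{F}_{2^m}$ the binary sequence $s^\infty=(s_t)_{t\ge0}$ is defined by $s_t=\operatorname{Tr}(F(\alpha^t+1))$; it is periodic with period dividing $v$. Its minimal polynomial $g_s(x)$ is the polynomial $1+c_1x+\dots+c_Lx^L\in\mathbb{F}_2[x]$ of least degree $L$ such that $s_i+c_1s_{i-1}+\dots+c_Ls_{i-L}=0$ for all $i\ge L$; its degree $L_s$ is the linear span of $s^\infty$. $\mathcal{C}_s$ denotes the binary cyclic code of length $v$ with generator polynomial $g_s(x)$. For an integer $i$, $m_{\alpha^i}(x)$ is the minimal polynomial of $\alpha^i$ over $\mathbb{F}_2$. For a positive integer $t$, $\Gamma_{(t)}=\{j:1\le j\le 2^t-1,\ j\text{ odd}\}$. Empty products equal $1$. $d(\mathcal{C})$ denotes minimum Hamming distance. *)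

theory Defs
  imports "HOL-Computational_Algebra.Polynomial" "HOL-Library.Cardinality"
begin

text \<open>Ambient field: a finite field 'a with CARD('a) = 2^m; the prime field F_2 is {0,1}.
  Binary polynomials (elements of F_2[x]) are represented as polynomials over 'a
  all of whose coefficients lie in {0,1}.\<close>

definition binpoly :: "'a::field poly \<Rightarrow> bool" where
  "binpoly p \<longleftrightarrow> (\<forall>i. coeff p i \<in> {0, 1})"

definition primitive_elem :: "'a::{field,finite} \<Rightarrow> bool" where
  "primitive_elem a \<longleftrightarrow> a \<noteq> 0 \<and> (\<forall>x. x \<noteq> 0 \<longrightarrow> (\<exists>k::nat. x = a ^ k))"

definition trace2 :: "nat \<Rightarrow> 'a::field \<Rightarrow> 'a" where
  "trace2 m x = (\<Sum>i<m. x ^ (2 ^ i))"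

definition is_minpoly_F2 :: "'a::field \<Rightarrow> 'a poly \<Rightarrow> bool" where
  "is_minpoly_F2 b p \<longleftrightarrow> binpoly p \<and> lead_coeff p = 1 \<and> poly p b = 0 \<and>
     (\<forall>q. binpoly q \<and> lead_coeff q = 1 \<and> poly q b = 0 \<longrightarrow> degree p \<le> degree q)"

definition minpoly_F2 :: "'a::field \<Rightarrow> 'a poly" where
  "minpoly_F2 b = (THE p. is_minpoly_F2 b p)"

definition seq_annihilates :: "(nat \<Rightarrow> 'a::field) \<Rightarrow> 'a poly \<Rightarrow> bool" where
  "seq_annihilates s g \<longleftrightarrow> binpoly g \<and> coeff g 0 = 1 \<and>
     (\<forall>i\<ge>degree g. (\<Sum>k\<le>degree g. coeff g k * s (i - k)) = 0)"

definition is_seq_minpoly :: "(nat \<Rightarrow> 'a::field) \<Rightarrow> 'a poly \<Rightarrow> bool" where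
  "is_seq_minpoly s g \<longleftrightarrow> seq_annihilates s g \<and>
     (\<forall>h. seq_annihilates s h \<longrightarrow> degree g \<le> degree h)"

definition seq_minpoly :: "(nat \<Rightarrow> 'a::field) \<Rightarrow> 'a poly" where
  "seq_minpoly s = (THE g. is_seq_minpoly s g)"

definition linear_span :: "(nat \<Rightarrow> 'a::field) \<Rightarrow> nat" where
  "linear_span s = degree (seq_minpoly s)"

text \<open>Binary cyclic code of length v with generator polynomial g; a codeword
  (c_0,...,c_{v-1}) is identified with c_0 + c_1 x + ... + c_{v-1} x^{v-1}.\<close>
definition cyclic_code :: "nat \<Rightarrow> 'a::field poly \<Rightarrow> 'a poly set" where
  "cyclic_code v g = {c. binpoly c \<and> (\<forall>i\<ge>v. coeff c i = 0) \<and> g dvd c}"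

definition hamming_dist :: "'a::zero poly \<Rightarrow> 'a poly \<Rightarrow> nat" where
  "hamming_dist c c' = card {i. coeff c i \<noteq> coeff c' i}"

definition min_dist :: "'a::zero poly set \<Rightarrow> nat" where
  "min_dist C = Min {hamming_dist c c' | c c'. c \<in> C \<and> c' \<in> C \<and> c \<noteq> c'}"

definition Gamma :: "nat \<Rightarrow> nat set" where
  "Gamma t = {j. 1 \<le> j \<and> j \<le> 2 ^ t - 1 \<and> odd j}"

end

theory Submission
  imports Defs
begin

text \<open>
  Write \<open>m = 2 * h\<close> and \<open>x = y + 1\<close>. The linear terms of \<open>f6\<close> cancel under the trace, and the
  \<open>2 ^ h\<close>-th power of \<open>x ^ (2 ^ m - 2 ^ h + 1)\<close> is \<open>(1 + y) ^ (2 ^ Suc h - 1)\<close>, which in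
  characteristic \<open>2\<close> is the sum of all \<open>y ^ k\<close> with \<open>k < 2 ^ Suc h\<close>. Since \<open>Tr (y ^ (2 * k)) = Tr (y ^ k)\<close>,
  an odd \<open>k\<close> with \<open>2 ^ j \<le> k < 2 ^ Suc j\<close> contributes \<open>h - j + 1\<close> times, so only the \<open>j\<close> of the same
  parity as \<open>h\<close> survive; \<open>k = 1 + 2 ^ h\<close> drops out because \<open>y ^ k\<close> lies in the subfield of order \<open>2 ^ h\<close>.
  The remaining \<open>\<alpha> ^ k\<close> have \<open>m\<close> conjugates each, all distinct, so \<open>s t\<close> is the sum of the \<open>t\<close>-th powers
  of a set \<open>R\<close> closed under squaring, and linear independence of the functions \<open>t \<mapsto> r ^ t\<close> identifies
  the minimal polynomial as the product of the \<open>X - inverse r\<close>. The odd exponents from \<open>2 ^ h + 3\<close> to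
  \<open>2 ^ Suc h - 1\<close> form an arithmetic progression of roots with difference \<open>2\<close>, and the BCH bound for
  the primitive element \<open>inverse \<alpha> ^ 2\<close> bounds the distance from below; the upper bound is the
  weight of the generator polynomial.
\<close>

section \<open>Products of linear factors\<close>

text \<open>The Vandermonde argument by interpolation: \<open>P\<close> vanishes at every node
  except \<open>f j\<close> and has degree below \<open>card S\<close>, so combining the hypotheses
  with its coefficients isolates \<open>b j\<close>. It serves both for linear independence of
  geometric sequences and for the BCH bound.\<close>

lemma weighted_power_sums_zero_imp:
  fixes f b :: "'i \<Rightarrow> 'a::field"
  assumes fin: "finite S" and inj: "inj_on f S"
    and zero: "\<And>k. k < card S \<Longrightarrow> (\<Sum>i\<in>S. b i * f i ^ k) = 0"
    and j: "j \<in> S"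
  shows "b j = 0"
proof -
  define P where "P = (\<Prod>i\<in>S - {j}. [:- f i, 1:])"
  have "degree P = card (S - {j})"
    unfolding P_def by (subst degree_prod_eq_sum_degree) auto
  then have deg: "degree P < card S"
    using fin j by (metis card_Diff1_less)
  have "0 = (\<Sum>k\<le>degree P. coeff P k * (\<Sum>i\<in>S. b i * f i ^ k))"
    using zero deg by (intro sum.neutral[symmetric]) auto
  also have "\<dots> = (\<Sum>i\<in>S. b i * poly P (f i))"
    unfolding poly_altdef sum_distrib_left by (subst sum.swap) (simp add: mult_ac)
  also have "\<dots> = (\<Sum>i\<in>S. if i = j then b j * poly P (f j) else 0)"
    using fin by (intro sum.cong) (auto simp: P_def poly_prod)
  also have "\<dots> = b j * poly P (f j)"
    using fin j by simp
  finally show ?thesis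
    using fin inj j by (auto simp: P_def poly_prod inj_on_def)
qed

lemma prod_linear_factors_dvd:
  fixes q :: "'a::field poly"
  assumes "finite S" "inj_on f S" "\<And>i. i \<in> S \<Longrightarrow> poly q (f i) = 0"
  shows "(\<Prod>i\<in>S. [:- f i, 1:]) dvd q"
  using assms
proof (induction S)
  case (insert j S)
  then obtain u where u: "q = (\<Prod>i\<in>S. [:- f i, 1:]) * u"
    by (auto elim!: dvdE)
  have "poly (\<Prod>i\<in>S. [:- f i, 1:]) (f j) \<noteq> 0"
    using insert by (auto simp: poly_prod)
  then have "[:- f j, 1:] dvd u"
    using insert.prems(2)[of j] u by (simp add: poly_eq_0_iff_dvd)
  then show ?case
    using insert.hyps u
    by (simp add: mult.commute[of "[:- f j, 1:]"] mult_dvd_mono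
        del: mult_pCons_left mult_pCons_right)
qed simp

lemma degree_prod_linear_factors:
  "degree (\<Prod>i\<in>S. [:- f i, 1 :: 'a::field:]) = card S"
  by (subst degree_prod_eq_sum_degree) auto

lemma lead_coeff_prod_linear_factors:
  "lead_coeff (\<Prod>i\<in>S. [:- f i, 1 :: 'a::field:]) = 1"
  by (simp add: lead_coeff_prod)

lemma dvd_same_degree_imp_smult:
  fixes p q :: "'a::field poly"
  assumes "p dvd q" "degree q = degree p" "q \<noteq> 0"
  obtains c where "q = smult c p"
proof -
  obtain u where u: "q = p * u" using assms(1) by (auto elim: dvdE)
  then have "degree u = 0" using assms by (auto simp: degree_mult_eq)
  then obtain c where "u = [:c:]" by (auto elim: degree_eq_zeroE)
  then show ?thesis using u that by simp
qed

section \<open>Characteristic two\<close>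

text \<open>Multiplication by a nonzero \<open>x\<close> permutes the nonzero elements, so their
  product can be cancelled.\<close>

lemma finite_field_power_card:
  fixes x :: "'a::{field,finite}"
  shows "x \<noteq> 0 \<Longrightarrow> x ^ (CARD('a) - 1) = 1" and "x ^ CARD('a) = x"
proof -
  have *: "x ^ (CARD('a) - 1) = 1" if "x \<noteq> 0"
  proof -
    let ?U = "UNIV - {0 :: 'a}"
    have "bij_betw ((*) x) ?U ?U"
      using that by (intro bij_betw_byWitness[where f' = "(*) (inverse x)"]) (auto simp: field_simps)
    then have "(\<Prod>y\<in>?U. y) = (\<Prod>y\<in>?U. x * y)"
      by (rule prod.reindex_bij_betw[symmetric])
    also have "\<dots> = x ^ (CARD('a) - 1) * (\<Prod>y\<in>?U. y)"
      by (simp add: prod.distrib card_Diff_singleton)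
    finally show ?thesis by simp
  qed
  then show "x \<noteq> 0 \<Longrightarrow> x ^ (CARD('a) - 1) = 1" .
  have "x * x ^ (CARD('a) - 1) = x"
    using * by (cases "x = 0") auto
  then show "x ^ CARD('a) = x"
    by (metis Suc_diff_1 finite_UNIV_card_ge_0 finite power_Suc)
qed

text \<open>Translation by \<open>1\<close> permutes the ring and so preserves the sum of its
  elements. This yields characteristic two from the cardinality alone.\<close>

lemma of_nat_card_finite_ring:
  "of_nat CARD('a) = (0 :: 'a::{ring_1,finite})"
proof -
  have "bij_betw (\<lambda>x::'a. x + 1) UNIV UNIV"
    by (intro bij_betw_byWitness[where f' = "\<lambda>x. x - 1"]) auto
  then have "(\<Sum>x\<in>UNIV. x) = (\<Sum>x\<in>UNIV. x + 1 :: 'a)"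
    by (rule sum.reindex_bij_betw[symmetric])
  then show ?thesis by (simp add: sum.distrib)
qed

lemma two_eq_0_if_card_power_2:
  assumes "CARD('a::{field,finite}) = 2 ^ m"
  shows "(2 :: 'a) = 0"
  using of_nat_card_finite_ring[where 'a = 'a] by (simp add: assms)

lemma minus_eq_self_char2:
  assumes "(2 :: 'a::ring_1) = 0"
  shows "- x = (x :: 'a)"
  using assms by (metis add_eq_0_iff mult_2 mult_zero_left)

lemma power2_add_char2:
  assumes "(2 :: 'a::comm_ring_1) = 0"
  shows "(x + y)\<^sup>2 = x\<^sup>2 + (y\<^sup>2 :: 'a)"
  using assms by (simp add: power2_sum)

lemma power2_sum_char2:
  assumes "(2 :: 'a::comm_ring_1) = 0"
  shows "(\<Sum>i\<in>A. f i)\<^sup>2 = (\<Sum>i\<in>A. (f i :: 'a)\<^sup>2)"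
  by (induction A rule: infinite_finite_induct) (auto simp: power2_add_char2[OF assms])

lemma power_2_power_sum_char2:
  assumes "(2 :: 'a::comm_ring_1) = 0"
  shows "(\<Sum>i\<in>A. f i) ^ 2 ^ n = (\<Sum>i\<in>A. (f i :: 'a) ^ 2 ^ n)"
proof (induction n)
  case (Suc n)
  then show ?case
    by (simp add: power2_sum_char2[OF assms] power_mult mult.commute[of 2])
qed simp

lemma power_2_power_add_char2:
  assumes "(2 :: 'a::comm_ring_1) = 0"
  shows "(x + y) ^ 2 ^ n = x ^ 2 ^ n + (y :: 'a) ^ 2 ^ n"
  using power_2_power_sum_char2[OF assms, where A = "UNIV :: bool set" and f = "\<lambda>b. if b then x else y"]
  by (simp add: UNIV_bool add.commute)

lemma inj_power_2_power_char2:
  assumes "(2 :: 'a::idom) = 0"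
  shows "inj (\<lambda>x::'a. x ^ 2 ^ n)"
proof (rule injI)
  fix x y :: 'a assume "x ^ 2 ^ n = y ^ 2 ^ n"
  moreover have "x ^ 2 ^ n = (x - y) ^ 2 ^ n + y ^ 2 ^ n"
    using power_2_power_add_char2[OF assms, of "x - y" y n] by simp
  ultimately show "x = y" by simp
qed

section \<open>Coefficientwise Frobenius and polynomials over the prime field\<close>

abbreviation frob_poly :: "'a::field poly \<Rightarrow> 'a poly" where
  "frob_poly \<equiv> map_poly (\<lambda>x. x\<^sup>2)"

lemma coeff_frob_poly: "coeff (frob_poly p) i = (coeff p i)\<^sup>2"
  by (simp add: coeff_map_poly)

text \<open>The prime field is the fixed set of squaring. As a fixed-point condition under a
  multiplicative map, being binary passes to products and, by cancellation, to quotients.\<close>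

lemma binpoly_iff_frob_poly: "binpoly p \<longleftrightarrow> frob_poly p = p"
proof -
  have "x \<in> {0, 1} \<longleftrightarrow> x\<^sup>2 = x" for x :: 'a
    by (auto simp: power2_eq_square)
  then show ?thesis
    unfolding binpoly_def poly_eq_iff coeff_frob_poly by blast
qed

lemma frob_poly_mult:
  assumes "(2 :: 'a::field) = 0"
  shows "frob_poly (p * q) = frob_poly p * frob_poly (q :: 'a poly)"
  by (intro poly_eqI)
    (simp add: coeff_frob_poly coeff_mult power2_sum_char2[OF assms] power_mult_distrib)

lemma frob_poly_prod:
  assumes "(2 :: 'a::field) = 0"
  shows "frob_poly (\<Prod>i\<in>A. f i) = (\<Prod>i\<in>A. frob_poly (f i :: 'a poly))"
  by (induction A rule: infinite_finite_induct)
    (auto simp: frob_poly_mult[OF assms] map_poly_1)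

lemma poly_binpoly_power2:
  assumes "(2 :: 'a::field) = 0" and "binpoly p"
  shows "poly p (x\<^sup>2) = (poly p x :: 'a)\<^sup>2"
proof -
  have "(coeff p i)\<^sup>2 = coeff p i" for i
    using assms(2) by (metis binpoly_iff_frob_poly coeff_frob_poly)
  then show ?thesis
    unfolding poly_altdef power2_sum_char2[OF assms(1)] power_mult_distrib
    by (simp add: power_commutes flip: power_mult) (simp add: mult.commute)
qed

lemma poly_binpoly_power_2_power:
  assumes "(2 :: 'a::field) = 0" and "binpoly p"
  shows "poly p (x ^ 2 ^ n) = (poly p x :: 'a) ^ 2 ^ n"
proof (induction n)
  case (Suc n)
  then show ?case
    using poly_binpoly_power2[OF assms, of "x ^ 2 ^ n"]
    by (simp add: mult.commute[of 2] power_mult)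
qed simp

lemma binpoly_diff:
  assumes "(2 :: 'a::field) = 0" and "binpoly p" "binpoly (q :: 'a poly)"
  shows "binpoly (p - q)"
  unfolding binpoly_def
proof
  fix i
  have "coeff p i \<in> {0, 1}" "coeff q i \<in> {0, 1}"
    using assms(2,3) by (simp_all add: binpoly_def)
  then show "coeff (p - q) i \<in> {0, 1}"
    using minus_eq_self_char2[OF assms(1), of 1] by auto
qed

lemma binpoly_mult_iff:
  assumes "(2 :: 'a::field) = 0" and "binpoly p" "p \<noteq> 0"
  shows "binpoly (p * q) \<longleftrightarrow> binpoly (q :: 'a poly)"
  using assms(2,3) by (simp add: binpoly_iff_frob_poly frob_poly_mult[OF assms(1)])

text \<open>Squaring is injective, hence permutes \<open>S\<close>, so the coefficientwise Frobenius
  only permutes the linear factors.\<close>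

lemma binpoly_prod_linear_factors:
  fixes S :: "'a::field set"
  assumes two: "(2 :: 'a) = 0" and fin: "finite S" and closed: "\<And>x. x \<in> S \<Longrightarrow> x\<^sup>2 \<in> S"
  shows "binpoly (\<Prod>x\<in>S. [:- x, 1:])"
proof -
  have "inj_on (\<lambda>x. x\<^sup>2) S"
    using inj_power_2_power_char2[OF two, of 1] by (simp add: inj_on_def)
  then have "bij_betw (\<lambda>x. x\<^sup>2) S S"
    using fin closed by (simp add: bij_betw_def endo_inj_surj image_subset_iff)
  then have "(\<Prod>x\<in>S. [:- x\<^sup>2, 1:]) = (\<Prod>x\<in>S. [:- x, 1:])"
    by (rule prod.reindex_bij_betw)
  moreover have "(- x)\<^sup>2 = - (x\<^sup>2)" for x :: 'a
    by (simp add: minus_eq_self_char2[OF two])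
  ultimately show ?thesis
    by (simp add: binpoly_iff_frob_poly frob_poly_prod[OF two] map_poly_pCons
        minus_eq_self_char2[OF two])
qed

section \<open>Minimal polynomials\<close>

text \<open>A binary polynomial vanishing at \<open>b\<close> vanishes at all its conjugates, so the
  product divides it; closure of the conjugates under squaring makes the product itself
  binary.\<close>

lemma minpoly_F2_eq_prod_conjugates:
  fixes b :: "'a::field"
  assumes two: "(2 :: 'a) = 0" and per: "b ^ 2 ^ m = b" and "m > 0"
    and inj: "inj_on (\<lambda>a. b ^ 2 ^ a) {..<m}"
  shows "minpoly_F2 b = (\<Prod>a<m. [:- (b ^ 2 ^ a), 1:])"
proof -
  define p where "p = (\<Prod>a<m. [:- (b ^ 2 ^ a), 1:])"
  let ?S = "(\<lambda>a. b ^ 2 ^ a) ` {..<m}"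
  have "x\<^sup>2 \<in> ?S" if x: "x \<in> ?S" for x
  proof -
    obtain a where a: "x = b ^ 2 ^ a" "a < m" using x by blast
    then have x2: "x\<^sup>2 = b ^ 2 ^ Suc a" by (simp add: mult.commute[of 2] power_mult)
    show ?thesis
    proof (cases "Suc a = m")
      case True
      then have "x\<^sup>2 = b ^ 2 ^ 0" using x2 per by (simp only: power_0 power_one_right)
      then show ?thesis using \<open>m > 0\<close> by (intro image_eqI[of _ _ 0]) auto
    next
      case False
      then show ?thesis using x2 a by (intro image_eqI[of _ _ "Suc a"]) auto
    qed
  qed
  then have "binpoly (\<Prod>x\<in>?S. [:- x, 1:])"
    by (intro binpoly_prod_linear_factors two) auto
  then have bin: "binpoly p"
    by (simp add: p_def prod.reindex[OF inj])
  have monic: "lead_coeff p = 1"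
    unfolding p_def by (rule lead_coeff_prod_linear_factors)
  have root: "poly p b = 0"
    using \<open>m > 0\<close> by (auto simp: p_def poly_prod intro!: bexI[of _ 0])
  have dvd: "p dvd q" if "binpoly q" "poly q b = 0" for q
    unfolding p_def using that
    by (intro prod_linear_factors_dvd inj) (auto simp: poly_binpoly_power_2_power[OF two])
  have le: "degree p \<le> degree q" if "binpoly q" "lead_coeff q = 1" "poly q b = 0" for q
    using dvd_imp_degree_le[OF dvd] that by force
  show ?thesis
    unfolding minpoly_F2_def p_def[symmetric]
  proof (rule the_equality)
    show "is_minpoly_F2 b p"
      using bin monic root le by (auto simp: is_minpoly_F2_def)
    fix q assume q: "is_minpoly_F2 b q"
    then have "degree q = degree p" "q \<noteq> 0" "p dvd q"
      using bin monic root le dvd by (auto simp: is_minpoly_F2_def intro: antisym)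
    then obtain c where c: "q = smult c p"
      by (metis dvd_same_degree_imp_smult)
    then have "lead_coeff q = c * lead_coeff p"
      by simp
    then have "c = 1"
      using q monic by (metis is_minpoly_F2_def mult.right_neutral)
    then show "q = p"
      using c by simp
  qed
qed

text \<open>Roots are inverted because \<open>seq_annihilates\<close> pairs \<open>coeff g k\<close> with \<open>s (i - k)\<close>.\<close>

lemma seq_minpoly_power_sum:
  fixes R :: "'a::field set"
  assumes two: "(2 :: 'a) = 0" and fin: "finite R" and nz: "0 \<notin> R"
    and closed: "\<forall>x\<in>R. x\<^sup>2 \<in> R"
    and s: "\<And>t. s t = (\<Sum>r\<in>R. r ^ t)"
  shows "seq_minpoly s = (\<Prod>r\<in>R. [:- inverse r, 1:])"
    and "binpoly (\<Prod>r\<in>R. [:- inverse r, 1:])"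
proof -
  define G where "G = (\<Prod>r\<in>R. [:- inverse r, 1:])"
  have inj: "inj_on inverse R"
    by (simp add: inj_on_def)
  have "binpoly (\<Prod>x\<in>inverse ` R. [:- x, 1:])"
  proof (intro binpoly_prod_linear_factors two)
    fix x assume "x \<in> inverse ` R"
    then obtain r where "r \<in> R" "x = inverse r" by auto
    then show "x\<^sup>2 \<in> inverse ` R" using closed by (auto simp: power_inverse)
  qed (use fin in auto)
  then have bin: "binpoly G"
    by (simp add: G_def prod.reindex[OF inj])
  then show "binpoly (\<Prod>r\<in>R. [:- inverse r, 1:])" by (simp add: G_def)
  have "coeff G 0 \<noteq> 0"
    using fin nz by (auto simp: G_def poly_prod simp flip: poly_0_coeff_0)
  then have G0: "coeff G 0 = 1"
    using bin by (auto simp: binpoly_def)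
  \<comment> \<open>Pulling \<open>r ^ i\<close> out of the window sum turns the recurrence into
    evaluation at \<open>inverse r\<close>.\<close>
  have conv: "(\<Sum>k\<le>degree g. coeff g k * s (i - k)) = (\<Sum>r\<in>R. r ^ i * poly g (inverse r))"
    if "i \<ge> degree g" for g i
  proof -
    have "(\<Sum>k\<le>degree g. coeff g k * s (i - k)) =
        (\<Sum>r\<in>R. \<Sum>k\<le>degree g. coeff g k * r ^ (i - k))"
      unfolding s sum_distrib_left by (rule sum.swap)
    also have "\<dots> = (\<Sum>r\<in>R. \<Sum>k\<le>degree g. r ^ i * (coeff g k * inverse r ^ k))"
    proof (intro sum.cong refl)
      fix r k assume "r \<in> R" "k \<in> {..degree g}"
      then have "r \<noteq> 0" "k \<le> i" using nz that by auto
      then show "coeff g k * r ^ (i - k) = r ^ i * (coeff g k * inverse r ^ k)"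
        by (simp add: power_diff field_simps)
    qed
    finally show ?thesis by (simp add: poly_altdef sum_distrib_left)
  qed
  have ann: "seq_annihilates s G"
    using bin G0 fin unfolding seq_annihilates_def
    by (auto simp: conv G_def poly_prod intro!: sum.neutral)
  have dvd: "G dvd g" if g: "seq_annihilates s g" for g
    unfolding G_def
  proof (intro prod_linear_factors_dvd fin inj)
    fix r assume r: "r \<in> R"
    \<comment> \<open>The recurrence at the indices \<open>degree g + k\<close> gives vanishing
      power sums for all \<open>k\<close>, so the weights must be zero.\<close>
    have "(\<Sum>r\<in>R. r ^ degree g * poly g (inverse r) * r ^ k) = 0" for k
      using g conv[of g "degree g + k"]
      by (simp add: seq_annihilates_def power_add mult_ac)
    then have "r ^ degree g * poly g (inverse r) = 0"
      by (intro weighted_power_sums_zero_imp[OF fin inj_on_id2 _ r,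
            where b = "\<lambda>r. r ^ degree g * poly g (inverse r)"])
    then show "poly g (inverse r) = 0" using r nz by auto
  qed
  have le: "degree G \<le> degree g" if "seq_annihilates s g" for g
  proof -
    have "g \<noteq> 0" using that by (auto simp: seq_annihilates_def)
    then show ?thesis using dvd[OF that] by (rule dvd_imp_degree_le[rotated])
  qed
  show "seq_minpoly s = (\<Prod>r\<in>R. [:- inverse r, 1:])"
    unfolding seq_minpoly_def G_def[symmetric]
  proof (rule the_equality)
    show "is_seq_minpoly s G"
      using ann le by (auto simp: is_seq_minpoly_def)
    fix g assume g: "is_seq_minpoly s g"
    then have "degree g = degree G" "g \<noteq> 0" "G dvd g"
      using ann le dvd by (auto simp: is_seq_minpoly_def seq_annihilates_def intro: antisym)
    then obtain c where c: "g = smult c G"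
      by (metis dvd_same_degree_imp_smult)
    \<comment> \<open>The constant coefficient is the one normalised to \<open>1\<close>, so it
      fixes the scalar.\<close>
    then show "g = G"
      using g G0 by (simp add: is_seq_minpoly_def seq_annihilates_def)
  qed
qed

section \<open>Cyclic codes\<close>

lemma card_binpoly_below:
  "card {p :: 'a::field poly. binpoly p \<and> (\<forall>i\<ge>n. coeff p i = 0)} = 2 ^ n" (is "card ?B = _")
proof -
  have "bij_betw (\<lambda>p :: 'a poly. {i. coeff p i \<noteq> 0}) ?B (Pow {..<n})"
  proof (rule bij_betw_imageI)
    show "inj_on (\<lambda>p :: 'a poly. {i. coeff p i \<noteq> 0}) ?B"
    proof (intro inj_onI poly_eqI)
      fix p q :: "'a poly" and i
      assume "p \<in> ?B" "q \<in> ?B" "{i. coeff p i \<noteq> 0} = {i. coeff q i \<noteq> 0}"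
      then have "coeff p i \<in> {0, 1}" "coeff q i \<in> {0, 1}" "coeff p i \<noteq> 0 \<longleftrightarrow> coeff q i \<noteq> 0"
        by (auto simp: binpoly_def)
      then show "coeff p i = coeff q i" by auto
    qed
    have "\<exists>p. p \<in> ?B \<and> A = {i. coeff p i \<noteq> 0}" if "A \<subseteq> {..<n}" for A
    proof -
      define p where "p = (\<Sum>i\<in>A. monom (1 :: 'a) i)"
      have "finite A" using that finite_subset by blast
      then have "coeff p i = (if i \<in> A then 1 else 0)" for i
        by (simp add: p_def coeff_sum)
      then show ?thesis using that by (intro exI[of _ p]) (auto simp: binpoly_def)
    qed
    then show "(\<lambda>p :: 'a poly. {i. coeff p i \<noteq> 0}) ` ?B = Pow {..<n}"
      by (fastforce simp: image_iff not_less[symmetric])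
  qed
  then show ?thesis by (simp add: bij_betw_same_card card_Pow)
qed

lemma card_cyclic_code:
  assumes two: "(2 :: 'a::field) = 0" and bin: "binpoly (g :: 'a poly)"
    and "g \<noteq> 0" and deg: "degree g \<le> v"
  shows "card (cyclic_code v g) = 2 ^ (v - degree g)"
proof -
  let ?B = "{p :: 'a poly. binpoly p \<and> (\<forall>i\<ge>v - degree g. coeff p i = 0)}"
  have below: "(\<forall>i\<ge>n. coeff p i = 0) \<longleftrightarrow> p = 0 \<or> degree p < n" for p :: "'a poly" and n
    by (metis coeff_0 coeff_eq_0 leading_coeff_neq_0 linorder_not_le order_less_le_trans)
  have "(\<forall>i\<ge>v. coeff (g * q) i = 0) \<longleftrightarrow> (\<forall>i\<ge>v - degree g. coeff q i = 0)" for q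
    unfolding below using \<open>g \<noteq> 0\<close> deg by (cases "q = 0") (auto simp: degree_mult_eq)
  then have "cyclic_code v g = (*) g ` ?B"
    using binpoly_mult_iff[OF two bin \<open>g \<noteq> 0\<close>]
    by (auto simp: cyclic_code_def elim!: dvdE)
  moreover have "inj_on ((*) g) ?B"
    using \<open>g \<noteq> 0\<close> by (simp add: inj_on_def)
  ultimately show ?thesis
    by (simp add: card_image card_binpoly_below)
qed

text \<open>The values at the \<open>n\<close> roots are power sums of the distinct nodes
  \<open>\<beta> ^ i\<close> with \<open>i\<close> in the support and weights
  \<open>coeff c i * b ^ i\<close>. With at most \<open>n\<close> support points the Vandermonde
  argument forces all weights to be zero.\<close>

lemma BCH_bound:
  fixes c :: "'a::field poly"
  assumes inj: "inj_on (\<lambda>i. \<beta> ^ i) {..<v}" and len: "\<forall>i\<ge>v. coeff c i = 0"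
    and "c \<noteq> 0" "b \<noteq> 0" and roots: "\<And>k. k < n \<Longrightarrow> poly c (b * \<beta> ^ k) = 0"
  shows "n < card {i. coeff c i \<noteq> 0}"
proof (rule ccontr)
  let ?S = "{i. coeff c i \<noteq> 0}"
  assume "\<not> n < card ?S"
  have sub: "?S \<subseteq> {..<v}" using len by (auto simp: not_less[symmetric])
  then have fin: "finite ?S" using finite_subset by blast
  have "(\<Sum>i\<in>?S. coeff c i * b ^ i * (\<beta> ^ i) ^ k) = 0" if "k < card ?S" for k
  proof -
    have "(\<Sum>i\<in>?S. coeff c i * b ^ i * (\<beta> ^ i) ^ k) = (\<Sum>i\<in>?S. coeff c i * (b * \<beta> ^ k) ^ i)"
      by (simp add: power_mult_distrib mult_ac flip: power_mult)
    also have "\<dots> = poly c (b * \<beta> ^ k)"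
      unfolding poly_altdef by (intro sum.mono_neutral_left) (auto intro: le_degree)
    finally show ?thesis using roots that \<open>\<not> n < card ?S\<close> by simp
  qed
  then have "coeff c i * b ^ i = 0" if "i \<in> ?S" for i
    using weighted_power_sums_zero_imp[OF fin inj_on_subset[OF inj sub] _ that,
        where b = "\<lambda>i. coeff c i * b ^ i"] by blast
  then have "coeff c i = 0" for i using \<open>b \<noteq> 0\<close> by fastforce
  then show False using \<open>c \<noteq> 0\<close> by (simp add: poly_eq_iff)
qed

text \<open>Differences of codewords are codewords, which reduces distance to weight. Since
  \<open>degree g < v\<close>, the generator is itself a codeword, of weight at most
  \<open>degree g + 1\<close>.\<close>

lemma min_dist_cyclic_code:
  assumes two: "(2 :: 'a::field) = 0" and bin: "binpoly (g :: 'a poly)"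
    and "g \<noteq> 0" and deg: "degree g < v"
    and weight: "\<forall>c\<in>cyclic_code v g - {0}. d \<le> card {i. coeff c i \<noteq> 0}"
  shows "d \<le> min_dist (cyclic_code v g)" and "min_dist (cyclic_code v g) \<le> degree g + 1"
proof -
  let ?C = "cyclic_code v g"
  let ?D = "{hamming_dist c c' | c c'. c \<in> ?C \<and> c' \<in> ?C \<and> c \<noteq> c'}"
  \<comment> \<open>\<open>card\<close> is \<open>0\<close> on infinite sets, so a nonzero
    cardinality gives the finiteness that \<open>Min\<close> relies on.\<close>
  have "card ?C \<noteq> 0" using card_cyclic_code[OF two bin] \<open>g \<noteq> 0\<close> deg by simp
  then have "finite ?C" by (metis card.infinite)
  then have "finite ((\<lambda>(c, c'). hamming_dist c c') ` (?C \<times> ?C))" by simp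
  then have fin: "finite ?D" by (rule rev_finite_subset) auto
  have "g \<in> ?C" "0 \<in> ?C"
    using bin deg by (auto simp: cyclic_code_def coeff_eq_0 binpoly_def)
  then have mem: "hamming_dist g 0 \<in> ?D" using \<open>g \<noteq> 0\<close> by blast
  have "{i. coeff g i \<noteq> coeff 0 i} \<subseteq> {..degree g}" by (auto intro: le_degree)
  then have "hamming_dist g 0 \<le> degree g + 1"
    unfolding hamming_dist_def by (metis card_atMost card_mono finite_atMost Suc_eq_plus1)
  then show "min_dist ?C \<le> degree g + 1"
    unfolding min_dist_def using Min_le[OF fin mem] by linarith
  have "d \<le> hamming_dist c c'" if "c \<in> ?C" "c' \<in> ?C" "c \<noteq> c'" for c c'
  proof -
    have "c - c' \<in> ?C - {0}" using that by (auto simp: cyclic_code_def binpoly_diff[OF two])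
    then have "d \<le> card {i. coeff (c - c') i \<noteq> 0}" using weight by blast
    then show ?thesis by (simp add: hamming_dist_def)
  qed
  then show "d \<le> min_dist ?C"
    unfolding min_dist_def using fin mem by (subst Min_ge_iff) auto
qed

section \<open>Folding sums by doubling\<close>

text \<open>Odd numbers are grouped by their number \<open>Suc j\<close> of binary digits. Block
  \<open>0\<close> is \<open>{1}\<close>, whereas \<open>Gamma 0\<close> is empty; this accounts for
  the extra factor at \<open>inverse \<alpha>\<close> when \<open>h\<close> is even.\<close>

definition odd_block :: "nat \<Rightarrow> nat set" where
  "odd_block j = {k. odd k \<and> 2 ^ j \<le> k \<and> k < 2 ^ Suc j}"

text \<open>For \<open>k\<close> in \<open>odd_block j\<close> with \<open>j \<le> n\<close>,
  exactly \<open>n - j + 1\<close> of the numbers \<open>k * 2 ^ i\<close> lie below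
  \<open>2 ^ Suc n\<close>; the selected blocks are those where this count is odd.\<close>

definition parity_blocks :: "nat \<Rightarrow> nat set" where
  "parity_blocks n = (\<Union>j\<in>{j. j \<le> n \<and> (even j \<longleftrightarrow> even n)}. odd_block j)"

lemma finite_odd_block [simp]: "finite (odd_block j)"
  by (rule finite_subset[of _ "{..<2 ^ Suc j}"]) (auto simp: odd_block_def)

lemma odd_block_disjoint: "i \<noteq> j \<Longrightarrow> odd_block i \<inter> odd_block j = {}"
proof (induction i j rule: linorder_wlog)
  case (le i j)
  then have "(2 :: nat) ^ Suc i \<le> 2 ^ j" by (intro power_increasing) auto
  then show ?case by (auto simp: odd_block_def)
qed (simp add: Int_commute)

lemma odd_block_0: "odd_block 0 = {1}"
  by (auto simp: odd_block_def)

lemma odd_block_Suc: "odd_block (Suc n) = (\<lambda>k. 2 * k + 1) ` {2 ^ n..<2 ^ Suc n}"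
  by (auto simp: odd_block_def elim!: oddE)

text \<open>Removing the leading binary digit preserves oddness because \<open>2 ^ j\<close> is even
  for \<open>j \<ge> 1\<close>.\<close>

lemma odd_block_eq_image_Gamma:
  assumes "j \<ge> 1"
  shows "odd_block j = (\<lambda>i. i + 2 ^ j) ` Gamma j"
proof (intro equalityI subsetI)
  fix k assume k: "k \<in> odd_block j"
  then have "odd (k - 2 ^ j)" "k - 2 ^ j < 2 ^ j" "k = (k - 2 ^ j) + 2 ^ j"
    using assms by (auto simp: odd_block_def)
  moreover from this(1) have "1 \<le> k - 2 ^ j"
    by (metis One_nat_def Suc_leI odd_pos)
  ultimately show "k \<in> (\<lambda>i. i + 2 ^ j) ` Gamma j"
    unfolding Gamma_def by (intro image_eqI[of _ _ "k - 2 ^ j"]) (simp_all, linarith)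
next
  fix k assume "k \<in> (\<lambda>i. i + 2 ^ j) ` Gamma j"
  then obtain i where "k = i + 2 ^ j" "odd i" "i \<le> 2 ^ j - 1" by (auto simp: Gamma_def)
  moreover from this have "i < 2 ^ j"
    by (metis Suc_diff_1 le_imp_less_Suc zero_less_numeral zero_less_power)
  ultimately show "k \<in> odd_block j"
    using assms by (auto simp: odd_block_def)
qed

lemma parity_blocks_Suc_Suc: "parity_blocks (Suc (Suc n)) = parity_blocks n \<union> odd_block (Suc (Suc n))"
proof -
  have "{j. j \<le> Suc (Suc n) \<and> (even j \<longleftrightarrow> even (Suc (Suc n)))} =
      insert (Suc (Suc n)) {j. j \<le> n \<and> (even j \<longleftrightarrow> even n)}"
    by (auto simp: le_Suc_eq)
  then show ?thesis by (auto simp: parity_blocks_def)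
qed

lemma parity_blocks_0: "parity_blocks 0 = {1}"
  by (auto simp: parity_blocks_def odd_block_0)

lemma parity_blocks_1: "parity_blocks (Suc 0) = {3}"
proof -
  have "{j. j \<le> Suc 0 \<and> (even j \<longleftrightarrow> even (Suc 0))} = {Suc 0}"
    by (auto simp: le_Suc_eq)
  then show ?thesis
    by (simp add: parity_blocks_def odd_block_Suc numeral_2_eq_2 numeral_3_eq_3)
qed

lemma finite_parity_blocks [simp]: "finite (parity_blocks n)"
  by (simp add: parity_blocks_def)

lemma parity_blocks_disjoint:
  assumes "n < j"
  shows "parity_blocks n \<inter> odd_block j = {}"
proof -
  have "odd_block i \<inter> odd_block j = {}" if "i \<le> n" for i
    using assms that by (intro odd_block_disjoint) simp
  then show ?thesis by (auto simp: parity_blocks_def)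
qed

lemma parity_blocks_bounds:
  assumes "k \<in> parity_blocks n"
  shows "odd k" and "k < 2 ^ Suc n"
proof -
  obtain j where j: "j \<le> n" "k \<in> odd_block j"
    using assms by (auto simp: parity_blocks_def)
  then have "(2 :: nat) ^ Suc j \<le> 2 ^ Suc n" by (intro power_increasing) auto
  moreover have "odd k" "k < 2 ^ Suc j"
    using j by (auto simp: odd_block_def)
  ultimately show "odd k" "k < 2 ^ Suc n"
    by linarith+
qed

lemma card_odd_block_Suc: "card (odd_block (Suc n)) = 2 ^ n"
  by (simp add: odd_block_Suc card_image inj_on_def)

text \<open>Each step of two adds \<open>2 ^ Suc n\<close>, a geometric progression of ratio
  \<open>4\<close>; the factor \<open>3\<close> avoids a division.\<close>

lemma card_parity_blocks:
  "3 * card (parity_blocks n) = (if even n then 2 ^ Suc n + 1 else 2 ^ Suc n - 1)"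
proof (induction n rule: induct_nat_012)
  case (ge2 n)
  have "card (parity_blocks (Suc (Suc n))) = card (parity_blocks n) + 2 ^ Suc n"
    unfolding parity_blocks_Suc_Suc
    by (subst card_Un_disjoint) (auto simp: parity_blocks_disjoint card_odd_block_Suc)
  moreover have "(2 :: nat) ^ Suc n \<ge> 1" by simp
  ultimately show ?case using ge2(1) by (cases "even n") auto
qed (auto simp: parity_blocks_0 parity_blocks_1)

lemma sum_lessThan_double:
  fixes T :: "nat \<Rightarrow> 'b::comm_monoid_add"
  shows "(\<Sum>k<2 * N. T k) = (\<Sum>k<N. T (2 * k)) + (\<Sum>k<N. T (2 * k + 1))"
  by (induction N) (simp_all add: add_ac)

text \<open>The induction advances by two so that the odd-index sum \<open>B (Suc n)\<close> occurs
  twice and cancels, leaving only the new block. \<open>T 0\<close> stays apart because doubling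
  fixes \<open>0\<close>.\<close>

lemma sum_two_power_fold:
  fixes T :: "nat \<Rightarrow> 'b::comm_ring_1"
  assumes two: "(2 :: 'b) = 0" and double: "\<And>k. T (2 * k) = T k"
  shows "(\<Sum>k<2 ^ Suc n. T k) = T 0 + (\<Sum>k\<in>parity_blocks n. T k)"
proof (induction n rule: induct_nat_012)
  have cancel: "x + (x + y) = y" for x y :: 'b
    by (metis add.assoc add.left_neutral mult_2 mult_zero_left two)
  {
    case 0
    show ?case by (simp add: parity_blocks_0 numeral_2_eq_2)
  next
    case 1
    have "(\<Sum>k<2 ^ Suc (Suc 0). T k) = T 1 + (T 1 + (T 0 + T 3))"
      using double[of 1] by (simp add: numeral_eq_Suc add_ac)
    then show ?case by (simp add: parity_blocks_1 cancel)
  next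
    case (ge2 n)
    define A where "A = (\<lambda>n. \<Sum>k<2 ^ n. T k)"
    define B where "B = (\<lambda>n. \<Sum>k<2 ^ n. T (2 * k + 1))"
    have step: "A (Suc i) = A i + B i" for i
      unfolding A_def B_def power_Suc sum_lessThan_double double ..
    have "{..<2 ^ Suc i} = {..<2 ^ i} \<union> {2 ^ i..<2 ^ Suc i :: nat}" for i
      by auto
    then have "B (Suc i) = B i + (\<Sum>k\<in>{2 ^ i..<2 ^ Suc i}. T (2 * k + 1))" for i
      unfolding B_def by (simp add: sum.union_disjoint ivl_disj_int del: power_Suc)
    moreover have "(\<Sum>k\<in>{2 ^ i..<2 ^ Suc i}. T (2 * k + 1)) = (\<Sum>k\<in>odd_block (Suc i). T k)" for i
      unfolding odd_block_Suc by (subst sum.reindex) (auto simp: inj_on_def)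
    ultimately have "A (Suc (Suc (Suc n))) =
        B (Suc n) + (B (Suc n) + (A (Suc n) + (\<Sum>k\<in>odd_block (Suc (Suc n)). T k)))"
      by (simp add: step add_ac)
    then show ?case
      using ge2(1) unfolding cancel parity_blocks_Suc_Suc
      by (subst sum.union_disjoint) (auto simp: parity_blocks_disjoint A_def add_ac simp del: power_Suc)
  }
qed

text \<open>All binomial coefficients of row \<open>2 ^ n - 1\<close> are odd. In the induction,
  squaring yields the even powers of \<open>y\<close>, and the remaining factor \<open>1 + y\<close>
  adds the odd ones.\<close>

lemma power_two_power_minus_1_char2:
  fixes y :: "'b::comm_ring_1"
  assumes two: "(2 :: 'b) = 0"
  shows "(1 + y) ^ (2 ^ n - 1) = (\<Sum>k<2 ^ n. y ^ k)"
proof (induction n)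
  case (Suc n)
  have "(2 :: nat) ^ Suc n - 1 = (2 ^ n - 1) * 2 + 1"
    using one_le_power[of "2 :: nat" n] unfolding power_Suc by linarith
  then have "(1 + y) ^ (2 ^ Suc n - 1) = ((1 + y) ^ (2 ^ n - 1))\<^sup>2 * (1 + y)"
    by (simp only: power_add power_mult power_one_right)
  also have "\<dots> = (\<Sum>k<2 ^ n. y ^ (2 * k)) * (1 + y)"
    by (simp only: Suc power2_sum_char2[OF two] power_mult[symmetric] mult.commute[of _ 2])
  also have "\<dots> = (\<Sum>k<2 ^ Suc n. y ^ k)"
    unfolding power_Suc sum_lessThan_double
    by (simp add: distrib_left sum_distrib_right power_commutes)
  finally show ?case .
qed simp

section \<open>The trace\<close>

lemma trace2_add:
  assumes "(2 :: 'a::field) = 0"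
  shows "trace2 m (x + y) = trace2 m x + trace2 m (y :: 'a)"
  by (simp add: trace2_def power_2_power_add_char2[OF assms] sum.distrib)

lemma trace2_sum:
  assumes "(2 :: 'a::field) = 0"
  shows "trace2 m (\<Sum>i\<in>A. f i) = (\<Sum>i\<in>A. trace2 m (f i :: 'a))"
  unfolding trace2_def power_2_power_sum_char2[OF assms] by (rule sum.swap)

lemma trace2_power2:
  assumes "x ^ 2 ^ m = (x :: 'a::field)"
  shows "trace2 m (x\<^sup>2) = trace2 m x"
proof -
  have "trace2 m (x\<^sup>2) + x = (\<Sum>i<m. x ^ 2 ^ Suc i) + x ^ 2 ^ 0"
    by (simp add: trace2_def flip: power_mult)
  also have "\<dots> = (\<Sum>i<Suc m. x ^ 2 ^ i)"
    by (simp only: sum.lessThan_Suc_shift add.commute)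
  also have "\<dots> = trace2 m x + x"
    by (simp add: trace2_def assms)
  finally show ?thesis by simp
qed

lemma trace2_power_2_power:
  assumes "\<And>x. x ^ 2 ^ m = (x :: 'a::field)"
  shows "trace2 m (x ^ 2 ^ n) = trace2 m (x :: 'a)"
proof (induction n)
  case (Suc n)
  then show ?case
    using trace2_power2[OF assms, of "x ^ 2 ^ n"] by (simp add: mult.commute[of 2] power_mult)
qed simp

text \<open>The conjugates with index \<open>i\<close> and \<open>i + h\<close> coincide, so the two
  halves of the trace cancel.\<close>

lemma trace2_eq_0_if_subfield:
  assumes "(2 :: 'a::field) = 0" and "x ^ 2 ^ h = (x :: 'a)"
  shows "trace2 (2 * h) x = 0"
proof -
  have "{..<2 * h} = {..<h} \<union> {h..<h + h}" by auto
  then have "trace2 (2 * h) x = (\<Sum>i<h. x ^ 2 ^ i) + (\<Sum>i\<in>{h..<h + h}. x ^ 2 ^ i)"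
    unfolding trace2_def by (simp add: sum.union_disjoint ivl_disj_int)
  also have "(\<Sum>i\<in>{h..<h + h}. x ^ 2 ^ i) = (\<Sum>i<h. x ^ 2 ^ (i + h))"
    using sum.shift_bounds_nat_ivl[of "\<lambda>i. x ^ 2 ^ i" 0 h h] by (simp add: lessThan_atLeast0)
  also have "\<dots> = (\<Sum>i<h. x ^ 2 ^ i)"
    by (simp add: power_add mult.commute[of _ "2 ^ h"] power_mult assms(2))
  finally show ?thesis
    using assms(1) by (metis mult_2 mult_zero_left)
qed

lemma trace2_f6:
  fixes y :: "'a::field"
  assumes two: "(2 :: 'a) = 0" and per: "\<And>x. x ^ 2 ^ (2 * h) = (x :: 'a)"
  defines "x \<equiv> y + 1"
  shows "trace2 (2 * h) (x + x ^ 2 ^ h + x ^ (2 ^ (2 * h) - 2 ^ h + 1)) =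
    (\<Sum>k\<in>parity_blocks h - {1 + 2 ^ h}. trace2 (2 * h) (y ^ k))"
proof -
  let ?Tr = "trace2 (2 * h) :: 'a \<Rightarrow> 'a"
  have Tr_pow: "?Tr (z ^ 2 ^ n) = ?Tr z" for z n
    using per by (rule trace2_power_2_power)
  have double: "z ^ 2 ^ (2 * h) = (z ^ 2 ^ h) ^ 2 ^ h" for z :: 'a
    by (simp add: mult_2 power_add power_mult)
  have "(2 :: nat) ^ (2 * h) - 2 ^ h + 1 = 2 ^ h * (2 ^ h - 1) + 1"
    by (simp add: mult_2 power_add diff_mult_distrib2)
  then have "x ^ (2 ^ (2 * h) - 2 ^ h + 1) = (x ^ 2 ^ h) ^ (2 ^ h - 1) * x"
    by (simp only: power_add power_mult power_one_right)
  also have "x ^ 2 ^ h = 1 + y ^ 2 ^ h"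
    by (simp add: x_def power_2_power_add_char2[OF two])
  finally have e: "x ^ (2 ^ (2 * h) - 2 ^ h + 1) = (1 + y ^ 2 ^ h) ^ (2 ^ h - 1) * x" .
  \<comment> \<open>The Frobenius power \<open>2 ^ h\<close> keeps the trace and, being an
    involution, returns \<open>y ^ 2 ^ h\<close> to \<open>y\<close>; the large exponent shrinks to
    \<open>2 ^ Suc h - 1\<close>.\<close>
  have "((1 + y ^ 2 ^ h) ^ (2 ^ h - 1) * x) ^ 2 ^ h = (1 + (y ^ 2 ^ h) ^ 2 ^ h) ^ (2 ^ h - 1) * (1 + y ^ 2 ^ h)"
    unfolding power_mult_distrib power_mult[symmetric] mult.commute[of "2 ^ h - 1"]
    by (simp add: power_mult power_2_power_add_char2[OF two] x_def)
  also have "\<dots> = (1 + y) ^ (2 ^ h - 1) * (1 + y) ^ 2 ^ h"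
    unfolding double[symmetric] per by (simp add: power_2_power_add_char2[OF two])
  also have "\<dots> = (\<Sum>k<2 ^ h. y ^ k) * (1 + y ^ 2 ^ h)"
    by (simp only: power_2_power_add_char2[OF two] power_two_power_minus_1_char2[OF two] power_one)
  also have "\<dots> = (\<Sum>k<2 ^ h. y ^ k) + (\<Sum>k\<in>{2 ^ h..<2 ^ h + 2 ^ h}. y ^ k)"
    using sum.shift_bounds_nat_ivl[of "\<lambda>i. y ^ i" 0 "2 ^ h" "2 ^ h"]
    by (simp add: lessThan_atLeast0 distrib_left sum_distrib_right power_add)
  also have "\<dots> = (\<Sum>k<2 ^ Suc h. y ^ k)"
    by (subst sum.union_disjoint[symmetric]) (auto intro!: sum.cong)
  finally have "?Tr (x ^ (2 ^ (2 * h) - 2 ^ h + 1)) = ?Tr (\<Sum>k<2 ^ Suc h. y ^ k)"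
    unfolding e by (metis Tr_pow)
  also have "\<dots> = ?Tr (y ^ 0) + (\<Sum>k\<in>parity_blocks h. ?Tr (y ^ k))"
  proof -
    have "?Tr (y ^ (2 * k)) = ?Tr (y ^ k)" for k
      using Tr_pow[of "y ^ k" 1] by (simp add: mult.commute flip: power_mult)
    then show ?thesis
      unfolding trace2_sum[OF two] by (rule sum_two_power_fold[OF two])
  qed
  \<comment> \<open>The constant \<open>1\<close> lies in the subfield; its trace is a sum of
    \<open>2 * h\<close> ones.\<close>
  also have "?Tr (y ^ 0) = 0"
    by (intro trace2_eq_0_if_subfield two) simp
  also have "(\<Sum>k\<in>parity_blocks h. ?Tr (y ^ k)) =
      (\<Sum>k\<in>parity_blocks h - {1 + 2 ^ h}. ?Tr (y ^ k))"
  proof (intro sum.mono_neutral_right ballI)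
    fix k assume "k \<in> parity_blocks h - (parity_blocks h - {1 + 2 ^ h})"
    then have k: "k = 1 + 2 ^ h" by blast
    \<comment> \<open>This power swaps the two factors \<open>y\<close> and \<open>y ^ 2 ^ h\<close>
      of \<open>y ^ k\<close>.\<close>
    have "(y ^ k) ^ 2 ^ h = y ^ 2 ^ h * (y ^ 2 ^ h) ^ 2 ^ h"
      by (simp add: k power_mult_distrib)
    also have "\<dots> = y ^ k"
      unfolding double[symmetric] per k by simp
    finally show "?Tr (y ^ k) = 0"
      by (intro trace2_eq_0_if_subfield two)
  qed auto
  finally have "?Tr (x ^ (2 ^ (2 * h) - 2 ^ h + 1)) = (\<Sum>k\<in>parity_blocks h - {1 + 2 ^ h}. ?Tr (y ^ k))"
    by simp
  moreover have "?Tr x + ?Tr x = 0"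
    using two by (metis mult_2 mult_zero_left)
  ultimately show ?thesis
    by (simp add: trace2_add[OF two] Tr_pow)
qed

section \<open>Primitive elements\<close>

text \<open>Reducing exponents modulo \<open>CARD('a) - 1\<close> shows that the powers below it
  already exhaust the nonzero elements, and counting makes them distinct.\<close>

lemma inj_on_power_primitive_elem:
  fixes \<alpha> :: "'a::{field,finite}"
  assumes "primitive_elem \<alpha>"
  shows "inj_on (\<lambda>i. \<alpha> ^ i) {..<CARD('a) - 1}"
proof (rule eq_card_imp_inj_on)
  let ?v = "CARD('a) - 1"
  have "\<alpha> \<noteq> 0" using assms by (simp add: primitive_elem_def)
  have "{0, 1 :: 'a} \<subseteq> UNIV" by simp
  then have "card {0, 1 :: 'a} \<le> CARD('a)" by (intro card_mono) auto
  then have "?v > 0" by simp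
  have "x \<in> (\<lambda>i. \<alpha> ^ i) ` {..<?v}" if "x \<noteq> 0" for x
  proof -
    obtain k where "x = \<alpha> ^ k" using assms \<open>x \<noteq> 0\<close> by (auto simp: primitive_elem_def)
    also have "k = ?v * (k div ?v) + k mod ?v" by simp
    also have "\<alpha> ^ \<dots> = \<alpha> ^ (k mod ?v)"
      unfolding power_add power_mult finite_field_power_card(1)[OF \<open>\<alpha> \<noteq> 0\<close>] by simp
    finally show ?thesis using \<open>?v > 0\<close> by (intro image_eqI[of _ _ "k mod ?v"]) auto
  qed
  then have "(\<lambda>i. \<alpha> ^ i) ` {..<?v} = UNIV - {0}"
    using \<open>\<alpha> \<noteq> 0\<close> by auto
  then show "card ((\<lambda>i. \<alpha> ^ i) ` {..<?v}) = card {..<?v}"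
    by (simp add: card_Diff_singleton)
qed simp

text \<open>Multiplying the exponent by \<open>2\<close> rotates its \<open>2 * h\<close> binary digits. An odd number with
  at most \<open>h + 1\<close> digits is rotated to another such number only by \<open>h\<close> places, and then both
  are \<open>1 + 2 ^ h\<close>.\<close>

lemma odd_exponent_conjugate_eq:
  fixes \<alpha> :: "'a::{field,finite}"
  assumes card: "CARD('a) = 2 ^ (2 * h)" and prim: "primitive_elem \<alpha>" and "h \<ge> 2"
    and p: "odd p" "p < 2 ^ Suc h" "p \<noteq> 1 + 2 ^ h"
    and q: "odd q" "q < 2 ^ Suc h" "q \<noteq> 1 + 2 ^ h"
    and "d < 2 * h" and eq: "\<alpha> ^ p = \<alpha> ^ (q * 2 ^ d)"
  shows "p = q" and "d = 0"
proof -
  let ?v = "2 ^ (2 * h) - 1 :: nat"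
  have per: "x ^ 2 ^ (2 * h) = x" for x :: 'a
    using finite_field_power_card(2)[of x] card by simp
  have cancel: "i = j" if "\<alpha> ^ i = \<alpha> ^ j" "i < ?v" "j < ?v" for i j
    using inj_on_power_primitive_elem[OF prim] that card by (auto simp: inj_on_def)
  have "(2 :: nat) ^ 2 \<le> 2 ^ h" using \<open>h \<ge> 2\<close> by (intro power_increasing) auto
  then have h4: "(4 :: nat) \<le> 2 ^ h" by simp
  have sq: "(2 :: nat) ^ (2 * h) = 2 ^ h * 2 ^ h" by (simp add: mult_2 power_add)
  have small: "i < ?v" if "i < 2 ^ Suc h" for i :: nat
  proof -
    have "4 * (2 :: nat) ^ h \<le> 2 ^ h * 2 ^ h" using h4 by (intro mult_right_mono) auto
    then show ?thesis using that h4 unfolding sq power_Suc by linarith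
  qed
  \<comment> \<open>A shift by fewer than \<open>h\<close> places stays below
    \<open>2 ^ (2 * h)\<close>, so equal powers have equal exponents, which parity contradicts. The
    shifted exponent is even, hence different from the odd \<open>?v\<close>, the one remaining
    value that \<open>cancel\<close> does not cover.\<close>
  have short: False
    if "\<alpha> ^ i = \<alpha> ^ (j * 2 ^ e)" "odd i" "i < 2 ^ Suc h" "j < 2 ^ Suc h" "0 < e" "e < h"
    for i j e :: nat
  proof -
    have "j * 2 ^ e < 2 ^ Suc h * 2 ^ e" using that by simp
    also have "\<dots> \<le> 2 ^ (2 * h)"
      unfolding power_add[symmetric] using that by (intro power_increasing) auto
    finally have "j * 2 ^ e < 2 ^ (2 * h)" .
    moreover have "even (j * 2 ^ e)" "odd ?v" using that \<open>h \<ge> 2\<close> by auto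
    then have "j * 2 ^ e \<noteq> ?v" by metis
    ultimately have "j * 2 ^ e < ?v" by linarith
    then have "i = j * 2 ^ e" using cancel small that by blast
    then show False using \<open>odd i\<close> \<open>0 < e\<close> by simp
  qed
  have "d = 0"
  proof (rule ccontr)
    assume "d \<noteq> 0"
    consider "d < h" | "d = h" | "d > h" by linarith
    then show False
    proof cases
      case 1
      then show False using short[OF eq] p q \<open>d \<noteq> 0\<close> by simp
    next
      case 3
      \<comment> \<open>The complementary Frobenius power exchanges the roles of \<open>p\<close>
        and \<open>q\<close> and makes the shift shorter than \<open>h\<close>.\<close>
      have "\<alpha> ^ (p * 2 ^ (2 * h - d)) = (\<alpha> ^ (q * 2 ^ d)) ^ 2 ^ (2 * h - d)"
        by (simp add: power_mult eq)
      also have "\<dots> = (\<alpha> ^ q) ^ (2 ^ d * 2 ^ (2 * h - d))"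
        by (simp only: power_mult)
      also have "\<dots> = \<alpha> ^ q"
        using \<open>d < 2 * h\<close> per by (simp flip: power_add)
      finally have "\<alpha> ^ q = \<alpha> ^ (p * 2 ^ (2 * h - d))" ..
      moreover have "0 < 2 * h - d" "2 * h - d < h" using 3 \<open>d < 2 * h\<close> by auto
      ultimately show False using short[of q p "2 * h - d"] p q by blast
    next
      case 2
      \<comment> \<open>Shifting \<open>q = r + 2 ^ h * c\<close> by \<open>h\<close> places swaps
        the low part \<open>r\<close> with the top bit \<open>c\<close>, which wraps around to the
        units. Oddness and size of \<open>p\<close> and \<open>q\<close> then force
        \<open>r = c = 1\<close>.\<close>
      define r c where "r = q mod 2 ^ h" and "c = q div 2 ^ h"
      have qrc: "q = r + 2 ^ h * c" by (simp add: r_def c_def)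
      have r: "r < 2 ^ h" by (simp add: r_def)
      have c: "c < 2" using q(2) by (simp add: c_def less_mult_imp_div_less)
      have "q * 2 ^ d = r * 2 ^ h + 2 ^ (2 * h) * c"
        unfolding qrc 2 sq by (simp add: distrib_left mult_ac)
      then have "\<alpha> ^ p = \<alpha> ^ (r * 2 ^ h + c)"
        using eq per[of \<alpha>] by (simp add: power_add power_mult)
      moreover have "r * 2 ^ h + c < ?v"
      proof -
        have "Suc r * 2 ^ h \<le> 2 ^ (2 * h)" unfolding sq using r by (intro mult_right_mono) auto
        then show ?thesis using c h4 by simp
      qed
      ultimately have pe: "p = r * 2 ^ h + c"
        using cancel small p by blast
      have "odd c" using p(1) \<open>h \<ge> 2\<close> unfolding pe by simp
      then have "c = 1" using c by (cases c) auto
      have "odd r" using q(1) \<open>h \<ge> 2\<close> unfolding qrc by simp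
      moreover have "r * 2 ^ h < 2 * 2 ^ h" using p(2) unfolding pe power_Suc by linarith
      then have "r < 2" unfolding mult_less_cancel2 by blast
      ultimately have "r = 1" by (cases r) auto
      then show False using q(3) qrc \<open>c = 1\<close> by simp
    qed
  qed
  then show "p = q" "d = 0" using eq cancel small p q by auto
qed

text \<open>Undoing the smaller of the two Frobenius powers reduces to the case of one unshifted
  exponent. Thus all orbits under squaring have full length \<open>2 * h\<close>, and distinct
  exponents in \<open>E\<close> give disjoint orbits.\<close>

lemma inj_on_odd_exponent_conjugates:
  fixes \<alpha> :: "'a::{field,finite}"
  assumes card: "CARD('a) = 2 ^ (2 * h)" and prim: "primitive_elem \<alpha>" and "h \<ge> 2"
    and E: "\<forall>k\<in>E. odd k \<and> k < 2 ^ Suc h \<and> k \<noteq> 1 + 2 ^ h"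
  shows "inj_on (\<lambda>(k, a). \<alpha> ^ (k * 2 ^ a)) (E \<times> {..<2 * h})"
proof -
  have le: "p = q \<and> a = b"
    if "p \<in> E" "q \<in> E" "a \<le> b" "b < 2 * h" "\<alpha> ^ (p * 2 ^ a) = \<alpha> ^ (q * 2 ^ b)" for p q a b
  proof -
    have "(\<alpha> ^ p) ^ 2 ^ a = (\<alpha> ^ (q * 2 ^ (b - a))) ^ 2 ^ a"
      using that by (simp add: mult.assoc flip: power_mult power_add)
    then have "\<alpha> ^ p = \<alpha> ^ (q * 2 ^ (b - a))"
      using inj_power_2_power_char2[OF two_eq_0_if_card_power_2[OF card], of a]
      by (auto dest: injD)
    then have "p = q" "b - a = 0"
      using odd_exponent_conjugate_eq[OF card prim \<open>h \<ge> 2\<close>, of p q "b - a"] E that by auto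
    then show ?thesis using \<open>a \<le> b\<close> by simp
  qed
  show ?thesis
  proof (intro inj_onI, clarsimp)
    fix p a q b
    assume "p \<in> E" "q \<in> E" "a < 2 * h" "b < 2 * h" "\<alpha> ^ (p * 2 ^ a) = \<alpha> ^ (q * 2 ^ b)"
    then show "p = q \<and> a = b"
      using le[of p q a b] le[of q p b a] by (cases "a \<le> b") auto
  qed
qed

text \<open>With \<open>R\<close> collecting all conjugates of the powers
  \<open>\<alpha> ^ k\<close>, the sequence becomes a sum of \<open>t\<close>-th powers over
  \<open>R\<close>; grouping the roots by \<open>k\<close> recovers the product of minimal
  polynomials.\<close>

lemma odd_exponent_trace_sequence:
  fixes \<alpha> :: "'a::{field,finite}"
  assumes card: "CARD('a) = 2 ^ (2 * h)" and prim: "primitive_elem \<alpha>" and "h \<ge> 2"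
    and E: "\<forall>k\<in>E. odd k \<and> k < 2 ^ Suc h \<and> k \<noteq> 1 + 2 ^ h"
    and s: "\<And>t. s t = (\<Sum>k\<in>E. trace2 (2 * h) ((\<alpha> ^ t) ^ k))"
  shows "seq_minpoly s = (\<Prod>k\<in>E. minpoly_F2 (inverse \<alpha> ^ k))"
    and "degree (seq_minpoly s) = 2 * h * card E"
    and "degree (seq_minpoly s) < 2 ^ (2 * h) - 1"
    and "binpoly (seq_minpoly s)"
    and "\<And>k. k \<in> E \<Longrightarrow> poly (seq_minpoly s) (inverse \<alpha> ^ k) = 0"
    and "seq_minpoly s \<noteq> 0"
proof -
  let ?m = "2 * h"
  let ?c = "\<lambda>(k, a). \<alpha> ^ (k * 2 ^ a)"
  define R where "R = ?c ` (E \<times> {..<?m})"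
  have two: "(2 :: 'a) = 0" by (rule two_eq_0_if_card_power_2[OF card])
  have per: "x ^ 2 ^ ?m = x" for x :: 'a
    using finite_field_power_card(2)[of x] card by simp
  have "\<alpha> \<noteq> 0" using prim by (simp add: primitive_elem_def)
  have finE: "finite E" by (rule finite_subset[of _ "{..<2 ^ Suc h}"]) (use E in auto)
  have inj: "inj_on ?c (E \<times> {..<?m})"
    by (rule inj_on_odd_exponent_conjugates[OF card prim \<open>h \<ge> 2\<close> E])
  have finR: "finite R" using finE by (simp add: R_def)
  have nz: "0 \<notin> R" using \<open>\<alpha> \<noteq> 0\<close> by (auto simp: R_def)
  have closed: "\<forall>x\<in>R. x\<^sup>2 \<in> R"
  proof
    fix x assume "x \<in> R"
    then obtain k a where x: "k \<in> E" "a < ?m" "x = \<alpha> ^ (k * 2 ^ a)"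
      by (auto simp: R_def)
    then have x2: "x\<^sup>2 = \<alpha> ^ (k * 2 ^ Suc a)"
      by (simp add: mult_ac flip: power_mult)
    show "x\<^sup>2 \<in> R"
    proof (cases "Suc a = ?m")
      case True
      then have "x\<^sup>2 = \<alpha> ^ (k * 2 ^ 0)"
        using x2 per[of "\<alpha> ^ k"] by (simp only: power_mult power_0 power_one_right)
      then show ?thesis
        unfolding R_def using x \<open>h \<ge> 2\<close> by (intro image_eqI[of _ _ "(k, 0)"]) auto
    next
      case False
      then show ?thesis
        unfolding R_def using x x2 by (intro image_eqI[of _ _ "(k, Suc a)"]) auto
    qed
  qed
  have sR: "s t = (\<Sum>r\<in>R. r ^ t)" for t
  proof -
    have "(\<Sum>r\<in>R. r ^ t) = (\<Sum>(k, a)\<in>E \<times> {..<?m}. (\<alpha> ^ (k * 2 ^ a)) ^ t)"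
      unfolding R_def sum.reindex[OF inj] by (simp add: case_prod_unfold)
    also have "\<dots> = s t"
      unfolding s trace2_def sum.cartesian_product[symmetric]
      by (simp add: mult_ac flip: power_mult)
    finally show ?thesis ..
  qed
  note min = seq_minpoly_power_sum[OF two finR nz closed sR]
  show "binpoly (seq_minpoly s)" unfolding min(1) by (rule min(2))
  show "seq_minpoly s \<noteq> 0" unfolding min(1) using finR by simp
  have conj: "inverse (\<alpha> ^ (k * 2 ^ a)) = (inverse \<alpha> ^ k) ^ 2 ^ a" for k a
    by (simp add: power_inverse power_mult)
  have "minpoly_F2 (inverse \<alpha> ^ k) = (\<Prod>a<?m. [:- ((inverse \<alpha> ^ k) ^ 2 ^ a), 1:])" if "k \<in> E" for k
  proof (rule minpoly_F2_eq_prod_conjugates[OF two per])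
    show "inj_on (\<lambda>a. (inverse \<alpha> ^ k) ^ 2 ^ a) {..<?m}"
      using inj \<open>k \<in> E\<close> by (auto simp: inj_on_def simp flip: conj)
  qed (use \<open>h \<ge> 2\<close> in auto)
  then have "(\<Prod>k\<in>E. minpoly_F2 (inverse \<alpha> ^ k)) =
      (\<Prod>(k, a)\<in>E \<times> {..<?m}. [:- inverse (\<alpha> ^ (k * 2 ^ a)), 1:])"
    unfolding prod.cartesian_product[symmetric] conj by (intro prod.cong) auto
  also have "\<dots> = (\<Prod>r\<in>R. [:- inverse r, 1:])"
    unfolding R_def prod.reindex[OF inj] by (simp add: case_prod_unfold)
  finally show "seq_minpoly s = (\<Prod>k\<in>E. minpoly_F2 (inverse \<alpha> ^ k))"
    by (simp add: min(1))
  have deg: "degree (seq_minpoly s) = card R"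
    unfolding min(1) by (rule degree_prod_linear_factors)
  then show "degree (seq_minpoly s) = 2 * h * card E"
    by (simp add: R_def card_image[OF inj] card_cartesian_product)
  \<comment> \<open>Excluding \<open>1\<close> as well as \<open>0\<close> makes \<open>R\<close> a
    proper subset of the nonzero elements; this gives the strict degree bound, so that the generator
    is a codeword.\<close>
  have "1 \<notin> R"
  proof
    assume "1 \<in> R"
    then obtain k a where ka: "k \<in> E" "1 = \<alpha> ^ (k * 2 ^ a)" by (auto simp: R_def)
    then have "(\<alpha> ^ k) ^ 2 ^ a = 1 ^ 2 ^ a" by (simp add: power_mult)
    then have "\<alpha> ^ k = 1"
      using inj_power_2_power_char2[OF two, of a] by (meson injD)
    moreover have "k < 2 ^ ?m - 1"
    proof -
      have "k < 2 ^ Suc h" using E ka by blast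
      also have "(2 :: nat) ^ Suc h \<le> 2 ^ (?m - 1)" using \<open>h \<ge> 2\<close> by (intro power_increasing) auto
      also have "\<dots> \<le> 2 ^ ?m - 1"
      proof -
        have "(2 :: nat) ^ ?m = 2 * 2 ^ (?m - 1)"
          using \<open>h \<ge> 2\<close> by (metis Suc_diff_1 mult_pos_pos order_less_le_trans pos2 power_Suc)
        then show ?thesis using one_le_power[of "2 :: nat" "?m - 1"] by linarith
      qed
      finally show ?thesis .
    qed
    ultimately have "k = 0"
      using inj_on_power_primitive_elem[OF prim] card
      by (auto simp: inj_on_def dest!: bspec[of _ _ k] bspec[of _ _ 0])
    then show False using E ka by auto
  qed
  then have "R \<subset> UNIV - {0}" using nz by auto
  then have "card R < card (UNIV - {0 :: 'a})" by (intro psubset_card_mono) auto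
  then show "degree (seq_minpoly s) < 2 ^ ?m - 1"
    by (simp add: deg card card_Diff_singleton)
  fix k assume "k \<in> E"
  then have "\<alpha> ^ (k * 2 ^ 0) \<in> R"
    unfolding R_def using \<open>h \<ge> 2\<close> by (intro image_eqI[of _ _ "(k, 0)"]) auto
  then show "poly (seq_minpoly s) (inverse \<alpha> ^ k) = 0"
    using finR by (auto simp: min(1) poly_prod power_inverse intro!: bexI[of _ "\<alpha> ^ k"])
qed

section \<open>The code\<close>

lemma one_plus_two_power_mem_odd_block:
  assumes "j \<ge> 1"
  shows "1 + 2 ^ j \<in> odd_block j"
proof -
  have "(2 :: nat) ^ 1 \<le> 2 ^ j" using assms by (intro power_increasing) auto
  then show ?thesis using assms by (auto simp: odd_block_def)
qed

text \<open>Only the outer blocks are special: the top one loses \<open>1 + 2 ^ h\<close>, that is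
  \<open>i = 1\<close>, and block \<open>0\<close>, present when \<open>h\<close> is even, consists
  of \<open>1\<close> alone.\<close>

lemma prod_parity_blocks:
  fixes F :: "nat \<Rightarrow> 'b::comm_monoid_mult"
  assumes "h \<ge> 2"
  shows "(\<Prod>k\<in>parity_blocks h - {1 + 2 ^ h}. F k) =
    (\<Prod>i\<in>Gamma h - {1}. F (i + 2 ^ h)) *
    (\<Prod>j\<in>{j. 1 \<le> j \<and> j \<le> h - 2 \<and> (even j \<longleftrightarrow> even h)}. \<Prod>i\<in>Gamma j. F (i + 2 ^ j)) *
    (if even h then F 1 else 1)"
proof -
  have block: "(\<Prod>k\<in>odd_block j. F k) = (\<Prod>i\<in>Gamma j. F (i + 2 ^ j))" if "j \<ge> 1" for j
    unfolding odd_block_eq_image_Gamma[OF that] by (subst prod.reindex) (auto simp: inj_on_def)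
  obtain n where h: "h = Suc (Suc n)"
    using assms by (metis add_2_eq_Suc le_Suc_ex)
  have mem: "1 + 2 ^ h \<in> odd_block h"
    using assms by (intro one_plus_two_power_mem_odd_block) simp
  then have "parity_blocks h - {1 + 2 ^ h} = (odd_block h - {1 + 2 ^ h}) \<union> parity_blocks n"
    using parity_blocks_disjoint[of n h] unfolding h parity_blocks_Suc_Suc by auto
  then have "(\<Prod>k\<in>parity_blocks h - {1 + 2 ^ h}. F k) =
      (\<Prod>k\<in>odd_block h - {1 + 2 ^ h}. F k) * (\<Prod>k\<in>parity_blocks n. F k)"
    using parity_blocks_disjoint[of n h] h by (simp only:) (subst prod.union_disjoint, auto)
  also have "odd_block h - {1 + 2 ^ h} = (\<lambda>i. i + 2 ^ h) ` (Gamma h - {1})"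
    using assms by (auto simp: odd_block_eq_image_Gamma)
  also have "(\<Prod>k\<in>\<dots>. F k) = (\<Prod>i\<in>Gamma h - {1}. F (i + 2 ^ h))"
    by (subst prod.reindex) (auto simp: inj_on_def)
  also have "(\<Prod>k\<in>parity_blocks n. F k) =
      (\<Prod>j\<in>{j. j \<le> n \<and> (even j \<longleftrightarrow> even n)}. \<Prod>k\<in>odd_block j. F k)"
    unfolding parity_blocks_def by (intro prod.UNION_disjoint) (auto dest: odd_block_disjoint)
  also have "{j. j \<le> n \<and> (even j \<longleftrightarrow> even n)} =
      {j. 1 \<le> j \<and> j \<le> n \<and> (even j \<longleftrightarrow> even n)} \<union> (if even n then {0} else {})"
    by (auto simp: Suc_le_eq odd_pos)
  also have "(\<Prod>j\<in>\<dots>. \<Prod>k\<in>odd_block j. F k) =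
      (\<Prod>j\<in>{j. 1 \<le> j \<and> j \<le> n \<and> (even j \<longleftrightarrow> even n)}. \<Prod>k\<in>odd_block j. F k) * (if even n then F 1 else 1)"
    by (subst prod.union_disjoint) (auto simp: odd_block_0)
  also have "(\<Prod>j\<in>{j. 1 \<le> j \<and> j \<le> n \<and> (even j \<longleftrightarrow> even n)}. \<Prod>k\<in>odd_block j. F k) =
      (\<Prod>j\<in>{j. 1 \<le> j \<and> j \<le> h - 2 \<and> (even j \<longleftrightarrow> even h)}. \<Prod>i\<in>Gamma j. F (i + 2 ^ j))"
    by (rule prod.cong) (auto simp: h block)
  finally show ?thesis by (simp add: h mult.assoc)
qed

theorem theorem6:
  fixes m :: nat and \<alpha> :: "'a::{field,finite}"
  assumes card: "CARD('a) = 2 ^ m"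
    and prim: "primitive_elem \<alpha>"
    and m4: "m \<ge> 4" and meven: "even m"
  defines "h \<equiv> m div 2"
  defines "v \<equiv> 2 ^ m - 1"
  defines "f6 \<equiv> (\<lambda>x::'a. x + x ^ (2 ^ h) + x ^ (2 ^ m - 2 ^ h + 1))"
  defines "s \<equiv> (\<lambda>t::nat. trace2 m (f6 (\<alpha> ^ t + 1)))"
  shows
    "(m mod 4 = 0 \<longrightarrow>
        seq_minpoly s =
          (\<Prod>i\<in>Gamma h - {1}. minpoly_F2 (inverse \<alpha> ^ (i + 2 ^ h))) *
          (\<Prod>j\<in>{j. 2 \<le> j \<and> j \<le> h - 2 \<and> even j}.
              \<Prod>i\<in>Gamma j. minpoly_F2 (inverse \<alpha> ^ (i + 2 ^ j))) *
          minpoly_F2 (inverse \<alpha>)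
      \<and> linear_span s = m * ((2 ^ (h + 1) - 2) div 3))
   \<and> (m mod 4 = 2 \<longrightarrow>
        seq_minpoly s =
          (\<Prod>i\<in>Gamma h - {1}. minpoly_F2 (inverse \<alpha> ^ (i + 2 ^ h))) *
          (\<Prod>j\<in>{j. 1 \<le> j \<and> j \<le> h - 2 \<and> odd j}.
              \<Prod>i\<in>Gamma j. minpoly_F2 (inverse \<alpha> ^ (i + 2 ^ j)))
      \<and> linear_span s = m * ((2 ^ (h + 1) - 4) div 3))
   \<and> card (cyclic_code v (seq_minpoly s)) = 2 ^ (v - linear_span s)
   \<and> 2 ^ ((m - 2) div 2) \<le> min_dist (cyclic_code v (seq_minpoly s))
   \<and> min_dist (cyclic_code v (seq_minpoly s)) \<le> linear_span s + 1"
proof -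
  have m: "m = 2 * h" and h2: "h \<ge> 2"
    using m4 meven by (auto simp: h_def)
  define E where "E = parity_blocks h - {1 + 2 ^ h}"
  let ?G = "seq_minpoly s"
  have two: "(2 :: 'a) = 0" by (rule two_eq_0_if_card_power_2[OF card])
  have per: "x ^ 2 ^ (2 * h) = x" for x :: 'a
    using finite_field_power_card(2)[of x] card by (simp add: m)
  have cardh: "CARD('a) = 2 ^ (2 * h)" using card by (simp add: m)
  have E: "\<forall>k\<in>E. odd k \<and> k < 2 ^ Suc h \<and> k \<noteq> 1 + 2 ^ h"
    using parity_blocks_bounds[of _ h] unfolding E_def by blast
  have "s t = (\<Sum>k\<in>E. trace2 (2 * h) ((\<alpha> ^ t) ^ k))" for t
    unfolding s_def f6_def E_def m by (rule trace2_f6[OF two per])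
  note seq = odd_exponent_trace_sequence[OF cardh prim h2 E this, folded m]
  have span: "linear_span s = m * card E"
    by (simp add: linear_span_def seq(2))
  have minpoly: "?G = (\<Prod>i\<in>Gamma h - {1}. minpoly_F2 (inverse \<alpha> ^ (i + 2 ^ h))) *
      (\<Prod>j\<in>{j. 1 \<le> j \<and> j \<le> h - 2 \<and> (even j \<longleftrightarrow> even h)}.
          \<Prod>i\<in>Gamma j. minpoly_F2 (inverse \<alpha> ^ (i + 2 ^ j))) *
      (if even h then minpoly_F2 (inverse \<alpha>) else 1)"
    unfolding seq(1) E_def prod_parity_blocks[OF h2] power_one_right ..
  have mem: "odd_block h \<subseteq> parity_blocks h"
    by (auto simp: parity_blocks_def)
  have "1 + 2 ^ h \<in> odd_block h"
    using h2 by (intro one_plus_two_power_mem_odd_block) simp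
  then have "card E = card (parity_blocks h) - 1"
    unfolding E_def using mem by (simp add: card_Diff_singleton subset_iff)
  \<comment> \<open>Removing \<open>1 + 2 ^ h\<close> lowers the tripled count by \<open>3\<close>;
    the equation makes the divisions by \<open>3\<close> exact.\<close>
  then have cardE: "3 * card E = (if even h then 2 ^ (h + 1) - 2 else 2 ^ (h + 1) - 4)"
    using card_parity_blocks[of h] by auto
  have mod0: "?G = (\<Prod>i\<in>Gamma h - {1}. minpoly_F2 (inverse \<alpha> ^ (i + 2 ^ h))) *
          (\<Prod>j\<in>{j. 2 \<le> j \<and> j \<le> h - 2 \<and> even j}.
              \<Prod>i\<in>Gamma j. minpoly_F2 (inverse \<alpha> ^ (i + 2 ^ j))) *
          minpoly_F2 (inverse \<alpha>)
      \<and> linear_span s = m * ((2 ^ (h + 1) - 2) div 3)" if "m mod 4 = 0"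
  proof -
    have "even h" using that unfolding m by presburger
    have "1 \<le> j \<and> j \<le> h - 2 \<and> (even j \<longleftrightarrow> even h) \<longleftrightarrow> 2 \<le> j \<and> j \<le> h - 2 \<and> even j" for j
      using \<open>even h\<close> by presburger
    moreover have "card E = (2 ^ (h + 1) - 2) div 3"
      using cardE \<open>even h\<close> by simp
    ultimately show ?thesis
      using \<open>even h\<close> by (simp add: minpoly span)
  qed
  have mod2: "?G = (\<Prod>i\<in>Gamma h - {1}. minpoly_F2 (inverse \<alpha> ^ (i + 2 ^ h))) *
          (\<Prod>j\<in>{j. 1 \<le> j \<and> j \<le> h - 2 \<and> odd j}.
              \<Prod>i\<in>Gamma j. minpoly_F2 (inverse \<alpha> ^ (i + 2 ^ j)))
      \<and> linear_span s = m * ((2 ^ (h + 1) - 4) div 3)" if "m mod 4 = 2"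
  proof -
    have "odd h" using that unfolding m by presburger
    moreover have "card E = (2 ^ (h + 1) - 4) div 3"
      using cardE \<open>odd h\<close> by simp
    ultimately show ?thesis
      by (simp add: minpoly span)
  qed
  have bin: "binpoly ?G" and deg: "degree ?G < v" and "?G \<noteq> 0"
    using seq(3,4,6) by (simp_all add: v_def)
  have card_code: "card (cyclic_code v ?G) = 2 ^ (v - linear_span s)"
    unfolding linear_span_def
    by (rule card_cyclic_code[OF two bin \<open>?G \<noteq> 0\<close>]) (use deg in simp)
  have weight: "\<forall>c\<in>cyclic_code v ?G - {0}. 2 ^ ((m - 2) div 2) \<le> card {i. coeff c i \<noteq> 0}"
  proof
    fix c assume "c \<in> cyclic_code v ?G - {0}"
    then have c: "c \<in> cyclic_code v ?G" "c \<noteq> 0" by auto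
    \<comment> \<open>This counts the odd numbers from \<open>2 ^ h + 3\<close> to
      \<open>2 ^ Suc h - 1\<close>; the run starts just after the removed
      \<open>1 + 2 ^ h\<close>.\<close>
    let ?n = "2 ^ (h - 1) - 1 :: nat"
    have pow: "(2 :: nat) ^ h = 2 * 2 ^ (h - 1)"
      using h2 by (metis Suc_diff_1 order_less_le_trans pos2 power_Suc)
    \<comment> \<open>Squaring is injective in characteristic two, so the square of
      \<open>inverse \<alpha>\<close> has distinct powers below \<open>v\<close> too.\<close>
    have "inj_on (\<lambda>i. ((inverse \<alpha>)\<^sup>2) ^ i) {..<v}"
    proof (rule inj_onI)
      fix i j assume ij: "i \<in> {..<v}" "j \<in> {..<v}" and "((inverse \<alpha>)\<^sup>2) ^ i = ((inverse \<alpha>)\<^sup>2) ^ j"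
      then have "(\<alpha> ^ i) ^ 2 ^ 1 = (\<alpha> ^ j) ^ 2 ^ 1"
        by (simp add: power_inverse mult.commute flip: power_mult)
      then have "\<alpha> ^ i = \<alpha> ^ j"
        using inj_power_2_power_char2[OF two, of 1] by (meson injD)
      then show "i = j"
        using inj_on_power_primitive_elem[OF prim] ij card by (auto simp: v_def inj_on_def)
    qed
    moreover have "\<forall>i\<ge>v. coeff c i = 0"
      using c by (simp add: cyclic_code_def)
    moreover have "inverse \<alpha> ^ (2 ^ h + 3) \<noteq> 0"
      using prim by (simp add: primitive_elem_def)
    moreover have "poly c (inverse \<alpha> ^ (2 ^ h + 3) * ((inverse \<alpha>)\<^sup>2) ^ k) = 0" if "k < ?n" for k
    proof -
      have "odd (2 ^ h + 3 + 2 * k)" using h2 by simp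
      moreover have "2 ^ h + 3 + 2 * k < 2 ^ Suc h" using \<open>k < ?n\<close> pow by simp
      ultimately have "2 ^ h + 3 + 2 * k \<in> odd_block h" by (simp add: odd_block_def)
      then have "2 ^ h + 3 + 2 * k \<in> E" using mem by (auto simp: E_def)
      then have "poly ?G (inverse \<alpha> ^ (2 ^ h + 3 + 2 * k)) = 0" by (rule seq(5))
      moreover have "?G dvd c" using c by (simp add: cyclic_code_def)
      ultimately show ?thesis by (auto simp: power_add power_mult elim!: dvdE)
    qed
    ultimately have "?n < card {i. coeff c i \<noteq> 0}"
      using BCH_bound \<open>c \<noteq> 0\<close> by blast
    moreover have "(m - 2) div 2 = h - 1" by (simp add: m)
    ultimately show "2 ^ ((m - 2) div 2) \<le> card {i. coeff c i \<noteq> 0}" by simp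
  qed
  note dist = min_dist_cyclic_code[OF two bin \<open>?G \<noteq> 0\<close> deg weight]
  show ?thesis
    using mod0 mod2 card_code dist[folded linear_span_def] by blast
qed

end
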